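(* Let $X$ be the mapping telescope of a sequence of topological spaces and continuous maps $$X_1\stackrel{f_1}{\longrightarrow}X_2\stackrel{f_2}{\longrightarrow}X_3\stackrel{f_3}{\longrightarrow}\cdots.$$ Then $\mathrm{TC}(X)\leq 2\max\{\mathrm{TC}(X_i);\ i=1,2,\ldots\}$.
   Context: Mapping telescope: $X=\bigcup_{i=1}^{\infty}X_i\times[i-1,i]$, i.e. the quotient space of the disjoint union $\bigsqcup_{i\geq 1}X_i\times[i-1,i]$ obtained by identifying $(x,i)\in X_i\times[i-1,i]$ with $(f_i(x),i)\in X_{i+1}\times[i,i+1]$ for all $i\geq 1$ and all $x\in X_i$. Topological complexity: for a topological space $Z$, let $I=[0,1]$, let $Z^I$ be the space of continuous paths $I\to Z$ with the compact-open topology, and let $\pi\colon Z^I\to Z\times Z$ be the fibration $\alpha\mapsto(\alpha(0),\alpha(1))$. The topological complexity $\mathrm{TC}(Z)$ is the least integer $n$ for which there exist an open cover $\{U_1,\ldots,U_n\}$ of $Z\times Z$ and continuous sections $s_i\colon U_i\to Z^I$ of $\pi$ (that is, $\pi\circ s_i$ is the inclusion $U_i\hookrightarrow Z\times Z$) for $i=1,\ldots,n$. If no such integer exists, $\mathrm{TC}(Z)=\infty$. (This is the non-reduced convention: a nonempty contractible space has $\mathrm{TC}=1$.) Convention: if the values $\mathrm{TC}(X_i)$ are not bounded above (in particular if some $\mathrm{TC}(X_i)=\infty$), then $\max\{\mathrm{TC}(X_i);\ i=1,2,\ldots\}=\infty$, and $2\cdot\infty=\infty$. *)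

theory Defs
  imports "HOL-Analysis.Analysis"
begin

subsection \<open>Quotient spaces\<close>

definition quotient_topology :: "'a topology \<Rightarrow> ('a \<times> 'a) set \<Rightarrow> 'a set topology" where
  "quotient_topology T r = topology (\<lambda>V. V \<subseteq> topspace T // r \<and> openin T (\<Union>V))"

lemma openin_quotient_topology:
  assumes r: "equiv (topspace T) r"
  shows "openin (quotient_topology T r) V \<longleftrightarrow> V \<subseteq> topspace T // r \<and> openin T (\<Union>V)"
proof -
  have "istopology (\<lambda>V. V \<subseteq> topspace T // r \<and> openin T (\<Union>V))"
    unfolding istopology_def
  proof (intro conjI allI impI)
    fix S V
    assume S: "S \<subseteq> topspace T // r \<and> openin T (\<Union>S)"
      and V: "V \<subseteq> topspace T // r \<and> openin T (\<Union>V)"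
    have "\<Union>(S \<inter> V) = \<Union>S \<inter> \<Union>V"
    proof (rule subset_antisym)
      show "\<Union>S \<inter> \<Union>V \<subseteq> \<Union>(S \<inter> V)"
      proof
        fix x assume "x \<in> \<Union>S \<inter> \<Union>V"
        then obtain c d where "c \<in> S" "x \<in> c" "d \<in> V" "x \<in> d" by blast
        moreover from this have "c = d"
          using quotient_disj[OF r, of c d] S V by blast
        ultimately show "x \<in> \<Union>(S \<inter> V)" by blast
      qed
    qed blast
    then show "openin T (\<Union>(S \<inter> V))" using S V by (simp add: openin_Int)
  next
    fix K
    assume K: "\<forall>V\<in>K. V \<subseteq> topspace T // r \<and> openin T (\<Union>V)"
    have "\<Union>(\<Union>K) = (\<Union>V\<in>K. \<Union>V)" by blast
    moreover have "openin T (\<Union>V\<in>K. \<Union>V)" using K by (intro openin_Union) blast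
    ultimately show "openin T (\<Union>(\<Union>K))" by (rule ssubst)
  qed blast+
  then show ?thesis
    by (simp add: quotient_topology_def)
qed

lemma topspace_quotient_topology:
  assumes r: "equiv (topspace T) r"
  shows "topspace (quotient_topology T r) = topspace T // r"
proof -
  have "openin (quotient_topology T r) (topspace T // r)"
    by (simp add: openin_quotient_topology[OF r] Union_quotient[OF r])
  then show ?thesis
    using openin_quotient_topology[OF r, of "topspace (quotient_topology T r)"]
    by (simp add: openin_subset subset_antisym)
qed

lemma quotient_map_quotient_topology:
  assumes r: "equiv (topspace T) r"
  shows "quotient_map T (quotient_topology T r) (\<lambda>x. r `` {x})"
  unfolding quotient_map_def topspace_quotient_topology[OF r]
proof (intro conjI allI impI)
  show "(\<lambda>x. r `` {x}) ` topspace T = topspace T // r"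
    by (auto simp: quotient_def)
  fix V assume V: "V \<subseteq> topspace T // r"
  have "{x \<in> topspace T. r `` {x} \<in> V} = \<Union>V"
  proof
    show "{x \<in> topspace T. r `` {x} \<in> V} \<subseteq> \<Union>V"
      using equiv_class_self[OF r] by blast
    show "\<Union>V \<subseteq> {x \<in> topspace T. r `` {x} \<in> V}"
    proof
      fix x assume "x \<in> \<Union>V"
      then obtain c where c: "c \<in> V" "x \<in> c" by blast
      then obtain y where y: "c = r `` {y}" "y \<in> topspace T"
        using V by (auto elim: quotientE)
      then have yx: "(y, x) \<in> r" using c by blast
      then have "r `` {x} \<in> V" using c y equiv_class_eq[OF r yx] by simp
      moreover have "x \<in> topspace T" using r yx by (rule equiv_class_eq_iff[THEN iffD1, THEN conjunct2, THEN conjunct2])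
      ultimately show "x \<in> {x \<in> topspace T. r `` {x} \<in> V}" by simp
    qed
  qed
  then show "openin T {x \<in> topspace T. r `` {x} \<in> V} \<longleftrightarrow> openin (quotient_topology T r) V"
    using V by (simp add: openin_quotient_topology[OF r])
qed


subsection \<open>The mapping telescope\<close>

text \<open>
  The sequence is indexed by \<open>i \<ge> 1\<close>; the values \<open>X 0\<close> and \<open>f 0\<close> are not used.
  A point \<open>(x, t)\<close> of the \<open>i\<close>-th cylinder is represented by \<open>(i, x, t)\<close>.
\<close>

definition telescope_sum :: "(nat \<Rightarrow> 'a topology) \<Rightarrow> (nat \<times> 'a \<times> real) topology" where
  "telescope_sum X =
     sum_topology (\<lambda>i. prod_topology (X i) (top_of_set {real i - 1..real i})) {1..}"

inductive telescope_step ::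
  "(nat \<Rightarrow> 'a topology) \<Rightarrow> (nat \<Rightarrow> 'a \<Rightarrow> 'a) \<Rightarrow> nat \<times> 'a \<times> real \<Rightarrow> nat \<times> 'a \<times> real \<Rightarrow> bool"
  for X f where
  "i \<ge> 1 \<Longrightarrow> x \<in> topspace (X i) \<Longrightarrow>
     telescope_step X f (i, x, real i) (Suc i, f i x, real i)"

definition telescope_rel ::
  "(nat \<Rightarrow> 'a topology) \<Rightarrow> (nat \<Rightarrow> 'a \<Rightarrow> 'a) \<Rightarrow> ((nat \<times> 'a \<times> real) \<times> (nat \<times> 'a \<times> real)) set" where
  "telescope_rel X f =
     {(p, q). p \<in> topspace (telescope_sum X) \<and> q \<in> topspace (telescope_sum X) \<and>
              equivclp (telescope_step X f) p q}"

lemma equiv_telescope_rel: "equiv (topspace (telescope_sum X)) (telescope_rel X f)"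
  by (rule equivI)
     (auto simp: telescope_rel_def refl_on_def
           intro!: symI transI intro: equivclp_sym equivclp_trans)

definition mapping_telescope ::
  "(nat \<Rightarrow> 'a topology) \<Rightarrow> (nat \<Rightarrow> 'a \<Rightarrow> 'a) \<Rightarrow> (nat \<times> 'a \<times> real) set topology" where
  "mapping_telescope X f = quotient_topology (telescope_sum X) (telescope_rel X f)"


subsection \<open>The path space and topological complexity\<close>

text \<open>
  Paths are represented by functions on the reals that take the value \<open>undefined\<close> outside
  the unit interval, so that equality of representatives is equality of paths.
\<close>

definition paths :: "'a topology \<Rightarrow> (real \<Rightarrow> 'a) set" where
  "paths Z = {\<alpha> \<in> extensional {0..1}. pathin Z \<alpha>}"

definition path_space :: "'a topology \<Rightarrow> (real \<Rightarrow> 'a) topology" where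
  "path_space Z = topology_generated_by
     {{\<alpha> \<in> paths Z. \<alpha> ` K \<subseteq> U} | K U. compact K \<and> K \<subseteq> {0..1} \<and> openin Z U}"

lemma topspace_path_space: "topspace (path_space Z) = paths Z"
proof -
  have "paths Z \<in> {{\<alpha> \<in> paths Z. \<alpha> ` K \<subseteq> U} | K U. compact K \<and> K \<subseteq> {0..1} \<and> openin Z U}"
    by (rule CollectI, rule exI[of _ "{}"], rule exI[of _ "{}"]) auto
  then show ?thesis
    unfolding path_space_def topology_generated_by_topspace by blast
qed

definition endpoints :: "(real \<Rightarrow> 'a) \<Rightarrow> 'a \<times> 'a" where
  "endpoints \<alpha> = (\<alpha> 0, \<alpha> 1)"

definition has_motion_planner :: "'a topology \<Rightarrow> nat \<Rightarrow> bool" where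
  "has_motion_planner Z n \<longleftrightarrow>
     (\<exists>(U :: nat \<Rightarrow> ('a \<times> 'a) set) (s :: nat \<Rightarrow> 'a \<times> 'a \<Rightarrow> real \<Rightarrow> 'a).
        (\<forall>i\<in>{1..n}. openin (prod_topology Z Z) (U i)) \<and>
        (\<Union>i\<in>{1..n}. U i) = topspace (prod_topology Z Z) \<and>
        (\<forall>i\<in>{1..n}.
           continuous_map (subtopology (prod_topology Z Z) (U i)) (path_space Z) (s i) \<and>
           (\<forall>p\<in>U i. endpoints (s i p) = p)))"

text \<open>The infimum of the empty set in \<^typ>\<open>enat\<close> is \<open>\<infinity>\<close>.\<close>

definition TC :: "'a topology \<Rightarrow> enat" where
  "TC Z = Inf {enat n | n. has_motion_planner Z n}"

end

theory Submission
  imports Defs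
begin

text \<open>
  A point of the telescope of height below \<open>k\<close> can be moved continuously up to level \<open>k\<close>, which is a
  copy of \<open>X (Suc k)\<close>. Hence over the set of pairs with both heights below \<open>k\<close> a motion planner of
  \<open>X (Suc k)\<close> gives one of the telescope: flow up, follow the planner, flow down. The bands
  \<open>k - 2 < max (height a) (height b) < k\<close> cover all pairs, and those with \<open>k\<close> of a fixed parity are
  pairwise disjoint, so that their planners can be merged; the two parities account for the factor 2.
\<close>

subsection \<open>Maps into path spaces\<close>

text \<open>Heights are unbounded, so no single level serves all pairs. The level has to vary with
  the pair, and planners built from different levels need not agree where their domains meet. This
  dictates the shape of the bands: open bands of width one would miss the pairs whose larger height
  is an integer, while width two with step one misses nothing, and two bands of equal parity share
  at most an end point, which both omit. Gluing infinitely many planners over disjoint open sets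
  costs no further sets, so each parity needs only as many sets as the common bound for the spaces
  \<open>X i\<close>.

  The spaces \<open>X i\<close> are arbitrary, and the flow has to descend to a quotient. It is
  therefore curried on the cylinders, and the resulting path-valued map is passed to the quotient. A
  homotopy on the quotient would instead raise the question whether the product of the quotient map
  with the interval is again a quotient map.\<close>

lemma continuous_map_path_space:
  "continuous_map A (path_space Z) g \<longleftrightarrow>
     (\<forall>a\<in>topspace A. g a \<in> paths Z) \<and>
     (\<forall>K U. compact K \<longrightarrow> K \<subseteq> {0..1} \<longrightarrow> openin Z U \<longrightarrow> openin A {a \<in> topspace A. g a ` K \<subseteq> U})"
    (is "?L \<longleftrightarrow> ?P \<and> ?R")
proof
  assume L: ?L
  then have P: ?P
    by (auto simp: continuous_map_def topspace_path_space)
  have "openin A {a \<in> topspace A. g a ` K \<subseteq> U}"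
    if "compact K" "K \<subseteq> {0..1}" "openin Z U" for K U
  proof -
    have "openin (path_space Z) {\<alpha> \<in> paths Z. \<alpha> ` K \<subseteq> U}"
      unfolding path_space_def by (rule topology_generated_by_Basis) (use that in blast)
    then have "openin A {a \<in> topspace A. g a \<in> {\<alpha> \<in> paths Z. \<alpha> ` K \<subseteq> U}}"
      by (rule openin_continuous_map_preimage[OF L])
    moreover have "{a \<in> topspace A. g a \<in> {\<alpha> \<in> paths Z. \<alpha> ` K \<subseteq> U}} = {a \<in> topspace A. g a ` K \<subseteq> U}"
      using P by blast
    ultimately show ?thesis by simp
  qed
  with P show "?P \<and> ?R" by blast
next
  assume R: "?P \<and> ?R"
  show ?L
    unfolding path_space_def
  proof (rule continuous_on_generated_topo)
    fix B assume "B \<in> {{\<alpha> \<in> paths Z. \<alpha> ` K \<subseteq> U} | K U. compact K \<and> K \<subseteq> {0..1} \<and> openin Z U}"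
    then obtain K U where B: "B = {\<alpha> \<in> paths Z. \<alpha> ` K \<subseteq> U}" "compact K" "K \<subseteq> {0..1}" "openin Z U"
      by blast
    then have "g -` B \<inter> topspace A = {a \<in> topspace A. g a ` K \<subseteq> U}"
      using R by blast
    then show "openin A (g -` B \<inter> topspace A)"
      using R B by simp
  next
    show "g ` topspace A \<subseteq> \<Union> {{\<alpha> \<in> paths Z. \<alpha> ` K \<subseteq> U} | K U. compact K \<and> K \<subseteq> {0..1} \<and> openin Z U}"
      using R topspace_path_space[of Z]
      unfolding path_space_def topology_generated_by_topspace by blast
  qed
qed

text \<open>This half of the exponential law holds for arbitrary \<open>A\<close> and
  \<open>Z\<close>: the sets \<open>K\<close> in the subbasis are compact, so the tube lemma
  thickens \<open>{a} \<times> K\<close> to a product neighbourhood inside the preimage of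
  \<open>U\<close>.\<close>

lemma continuous_map_curry_path_space:
  assumes g: "continuous_map (prod_topology A (top_of_set {0..1})) Z g"
  shows "continuous_map A (path_space Z) (\<lambda>a. restrict (\<lambda>s. g (a, s)) {0..1})"
  unfolding continuous_map_path_space
proof (intro conjI ballI allI impI)
  fix a assume a: "a \<in> topspace A"
  have "continuous_map (top_of_set {0..1}) Z (g \<circ> (\<lambda>s. (a, s)))"
    by (rule continuous_map_compose[OF _ g]) (use a in \<open>simp add: continuous_map_pairwise o_def\<close>)
  then show "restrict (\<lambda>s. g (a, s)) {0..1} \<in> paths Z"
    unfolding paths_def pathin_def
    by (auto elim!: continuous_map_eq)
next
  fix K :: "real set" and U
  assume K: "compact K" "K \<subseteq> {0..1}" and U: "openin Z U"
  let ?W = "{p \<in> topspace (prod_topology A (top_of_set {0..1})). g p \<in> U}"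
  have W: "openin (prod_topology A (top_of_set {0..1})) ?W"
    by (rule openin_continuous_map_preimage[OF g U])
  have K': "compactin (top_of_set {0..1}) K"
    using K by (simp add: compactin_subtopology)
  show "openin A {a \<in> topspace A. restrict (\<lambda>s. g (a, s)) {0..1} ` K \<subseteq> U}"
  proof (subst openin_subopen, intro ballI)
    fix a assume "a \<in> {a \<in> topspace A. restrict (\<lambda>s. g (a, s)) {0..1} ` K \<subseteq> U}"
    then have a: "a \<in> topspace A" "restrict (\<lambda>s. g (a, s)) {0..1} ` K \<subseteq> U" by auto
    have "{a} \<times> K \<subseteq> ?W"
      using a K by (auto simp: image_subset_iff subset_iff)
    from tube_lemma_right[OF W K' a(1) this]
    obtain P Q where PQ: "openin A P" "a \<in> P" "K \<subseteq> Q" "P \<times> Q \<subseteq> ?W"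
      by blast
    have "P \<subseteq> {a \<in> topspace A. restrict (\<lambda>s. g (a, s)) {0..1} ` K \<subseteq> U}"
    proof
      fix b assume "b \<in> P"
      then have "(b, s) \<in> ?W" if "s \<in> K" for s
        using PQ that by blast
      then show "b \<in> {a \<in> topspace A. restrict (\<lambda>s. g (a, s)) {0..1} ` K \<subseteq> U}"
        using \<open>b \<in> P\<close> openin_subset[OF PQ(1)] K by auto
    qed
    then show "\<exists>T. openin A T \<and> a \<in> T \<and> T \<subseteq> {a \<in> topspace A. restrict (\<lambda>s. g (a, s)) {0..1} ` K \<subseteq> U}"
      using PQ by blast
  qed
qed

section \<open>Reversing, joining and transporting paths continuously\<close>

definition rev_path :: "(real \<Rightarrow> 'a) \<Rightarrow> real \<Rightarrow> 'a" where
  "rev_path \<alpha> = restrict (\<lambda>t. \<alpha> (1 - t)) {0..1}"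

definition join_path :: "(real \<Rightarrow> 'a) \<Rightarrow> (real \<Rightarrow> 'a) \<Rightarrow> real \<Rightarrow> 'a" where
  "join_path \<alpha> \<beta> = restrict (\<lambda>t. if t \<le> 1/2 then \<alpha> (2 * t) else \<beta> (2 * t - 1)) {0..1}"

lemma rev_path_endpoints [simp]: "rev_path \<alpha> 0 = \<alpha> 1" "rev_path \<alpha> 1 = \<alpha> 0"
  by (simp_all add: rev_path_def)

lemma join_path_endpoints [simp]: "join_path \<alpha> \<beta> 0 = \<alpha> 0" "join_path \<alpha> \<beta> 1 = \<beta> 1"
  by (simp_all add: join_path_def)

lemma paths_reparam:
  assumes \<alpha>: "\<alpha> \<in> paths Z" and \<phi>: "continuous_on S \<phi>" "\<phi> ` S \<subseteq> {0..1}"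
  shows "continuous_map (top_of_set S) Z (\<lambda>t. \<alpha> (\<phi> t))"
proof -
  have "continuous_map (top_of_set S) (top_of_set {0..1}) \<phi>"
    using \<phi> by auto
  then show ?thesis
    using continuous_map_compose[of "top_of_set S" "top_of_set {0..1}" \<phi> Z \<alpha>] \<alpha>
    by (simp add: o_def paths_def pathin_def)
qed

lemma rev_path_in_paths:
  assumes "\<alpha> \<in> paths Z"
  shows "rev_path \<alpha> \<in> paths Z"
proof -
  have "continuous_map (top_of_set {0..1}) Z (\<lambda>t. \<alpha> (1 - t))"
    by (rule paths_reparam[OF assms]) (auto intro!: continuous_intros)
  then show ?thesis
    unfolding paths_def pathin_def rev_path_def by (auto elim!: continuous_map_eq)
qed

lemma join_path_in_paths:
  assumes \<alpha>: "\<alpha> \<in> paths Z" and \<beta>: "\<beta> \<in> paths Z" and eq: "\<alpha> 1 = \<beta> 0"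
  shows "join_path \<alpha> \<beta> \<in> paths Z"
proof -
  have "continuous_map (top_of_set {0..1}) Z (\<lambda>t. if t \<le> 1/2 then \<alpha> (2 * t) else \<beta> (2 * t - 1))"
  proof (rule continuous_map_cases_le)
    show "continuous_map (subtopology (top_of_set {0..1}) {x \<in> topspace (top_of_set {0..1}). x \<le> 1/2}) Z (\<lambda>t. \<alpha> (2 * t))"
      unfolding subtopology_subtopology
      by (rule paths_reparam[OF \<alpha>]) (auto intro!: continuous_intros)
    show "continuous_map (subtopology (top_of_set {0..1}) {x \<in> topspace (top_of_set {0..1}). 1/2 \<le> x}) Z (\<lambda>t. \<beta> (2 * t - 1))"
      unfolding subtopology_subtopology
      by (rule paths_reparam[OF \<beta>]) (auto intro!: continuous_intros)
    show "\<alpha> (2 * x) = \<beta> (2 * x - 1)" if "x = 1/2" for x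
      unfolding that using eq by simp
  qed auto
  then show ?thesis
    unfolding paths_def pathin_def join_path_def by (auto elim!: continuous_map_eq)
qed

text \<open>Reversal turns the subbasic condition for \<open>K\<close> and \<open>U\<close> into the
  one for the mirror image of \<open>K\<close> and \<open>U\<close>.\<close>

lemma continuous_map_rev_path:
  assumes g: "continuous_map A (path_space Z) g"
  shows "continuous_map A (path_space Z) (\<lambda>a. rev_path (g a))"
  unfolding continuous_map_path_space
proof (intro conjI ballI allI impI)
  show "rev_path (g a) \<in> paths Z" if "a \<in> topspace A" for a
    using g that by (auto simp: continuous_map_path_space rev_path_in_paths)
next
  fix K :: "real set" and U
  assume K: "compact K" "K \<subseteq> {0..1}" and U: "openin Z U"
  let ?K = "(\<lambda>t. 1 - t) ` K"
  have "compact ?K" "?K \<subseteq> {0..1}"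
    using K by (auto intro!: compact_continuous_image continuous_intros)
  then have "openin A {a \<in> topspace A. g a ` ?K \<subseteq> U}"
    using g U unfolding continuous_map_path_space by blast
  moreover have "rev_path \<alpha> ` K = \<alpha> ` ?K" for \<alpha> :: "real \<Rightarrow> 'b"
    using K unfolding rev_path_def image_image by (intro image_cong) auto
  ultimately show "openin A {a \<in> topspace A. rev_path (g a) ` K \<subseteq> U}"
    by simp
qed

text \<open>Cutting \<open>K\<close> at 1/2 and rescaling both pieces gives two compact sets, and
  the condition on the joined path is the conjunction of the conditions on its two halves.\<close>

lemma continuous_map_join_path:
  assumes g: "continuous_map A (path_space Z) g" and h: "continuous_map A (path_space Z) h"
    and eq: "\<And>a. a \<in> topspace A \<Longrightarrow> g a 1 = h a 0"
  shows "continuous_map A (path_space Z) (\<lambda>a. join_path (g a) (h a))"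
  unfolding continuous_map_path_space
proof (intro conjI ballI allI impI)
  show "join_path (g a) (h a) \<in> paths Z" if "a \<in> topspace A" for a
    using g h eq that by (auto simp: continuous_map_path_space join_path_in_paths)
next
  fix K :: "real set" and U
  assume K: "compact K" "K \<subseteq> {0..1}" and U: "openin Z U"
  let ?L = "(\<lambda>t. 2 * t) ` (K \<inter> {0..1/2})" and ?R = "(\<lambda>t. 2 * t - 1) ` (K \<inter> {1/2..1})"
  have "compact ?L" "?L \<subseteq> {0..1}" "compact ?R" "?R \<subseteq> {0..1}"
    using K by (auto intro!: compact_continuous_image continuous_intros compact_Int)
  then have "openin A ({a \<in> topspace A. g a ` ?L \<subseteq> U} \<inter> {a \<in> topspace A. h a ` ?R \<subseteq> U})"
    using g h U unfolding continuous_map_path_space by blast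
  moreover have split: "join_path \<alpha> \<beta> ` K \<subseteq> U \<longleftrightarrow> \<alpha> ` ?L \<subseteq> U \<and> \<beta> ` ?R \<subseteq> U" if "\<alpha> 1 = \<beta> 0" for \<alpha> \<beta> :: "real \<Rightarrow> 'b"
  proof -
    have "join_path \<alpha> \<beta> ` (K \<inter> {0..1/2}) = \<alpha> ` ?L"
      unfolding image_image by (rule image_cong) (auto simp: join_path_def)
    \<comment> \<open>At 1/2 the definition takes the branch of \<alpha>, so the formula with
      \<beta> is correct there only because the two paths meet.\<close>
    moreover have "join_path \<alpha> \<beta> t = \<beta> (2 * t - 1)" if "t \<in> {1/2..1}" for t
      proof (cases "t = 1/2")
      case True
      then show ?thesis
        using \<open>\<alpha> 1 = \<beta> 0\<close> unfolding True by (simp add: join_path_def)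
    qed (use that in \<open>auto simp: join_path_def\<close>)
    then have "join_path \<alpha> \<beta> ` (K \<inter> {1/2..1}) = \<beta> ` ?R"
      unfolding image_image by (intro image_cong) auto
    moreover have "K = K \<inter> {0..1/2} \<union> K \<inter> {1/2..1}"
      using K by force
    ultimately show ?thesis
      by (metis image_Un Un_subset_iff)
  qed
  then have "{a \<in> topspace A. join_path (g a) (h a) ` K \<subseteq> U} =
      {a \<in> topspace A. g a ` ?L \<subseteq> U} \<inter> {a \<in> topspace A. h a ` ?R \<subseteq> U}"
    unfolding Collect_conj_eq[symmetric]
    using split[of "g a" "h a" for a, OF eq] by (intro Collect_cong) metis
  ultimately show "openin A {a \<in> topspace A. join_path (g a) (h a) ` K \<subseteq> U}"
    by simp
qed

lemma continuous_map_path_space_postcompose: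
  assumes g: "continuous_map A (path_space Y) g" and \<phi>: "continuous_map Y Z \<phi>"
  shows "continuous_map A (path_space Z) (\<lambda>a. restrict (\<phi> \<circ> g a) {0..1})"
  unfolding continuous_map_path_space
proof (intro conjI ballI allI impI)
  fix a assume "a \<in> topspace A"
  then have "pathin Y (g a)"
    using g by (auto simp: continuous_map_path_space paths_def)
  then have "continuous_map (top_of_set {0..1}) Z (\<phi> \<circ> g a)"
    unfolding pathin_def using \<phi> by (rule continuous_map_compose)
  then show "restrict (\<phi> \<circ> g a) {0..1} \<in> paths Z"
    unfolding paths_def pathin_def by (auto elim!: continuous_map_eq)
next
  fix K :: "real set" and U
  assume K: "compact K" "K \<subseteq> {0..1}" and U: "openin Z U"
  let ?U = "{y \<in> topspace Y. \<phi> y \<in> U}"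
  have "openin Y ?U"
    by (rule openin_continuous_map_preimage[OF \<phi> U])
  then have "openin A {a \<in> topspace A. g a ` K \<subseteq> ?U}"
    using g K unfolding continuous_map_path_space by blast
  moreover have "{a \<in> topspace A. restrict (\<phi> \<circ> g a) {0..1} ` K \<subseteq> U} = {a \<in> topspace A. g a ` K \<subseteq> ?U}"
  proof -
    have "g a t \<in> topspace Y" if "a \<in> topspace A" "t \<in> K" for a t
    proof -
      have "continuous_map (top_of_set {0..1}) Y (g a)"
        using g that by (simp add: continuous_map_path_space paths_def pathin_def)
      then show ?thesis
        using that K by (auto simp: continuous_map_def Pi_iff)
    qed
    then show ?thesis
      using K by (auto simp: image_subset_iff subset_iff)
  qed
  ultimately show "openin A {a \<in> topspace A. restrict (\<phi> \<circ> g a) {0..1} ` K \<subseteq> U}"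
    by simp
qed


subsection \<open>Open sets with a motion planner\<close>

text \<open>The section is hidden behind an existential quantifier, so that open sets can be shrunk,
  pulled back and united without carrying their planners along.\<close>

definition sectional :: "'a topology \<Rightarrow> ('a \<times> 'a) set \<Rightarrow> bool" where
  "sectional Z U \<longleftrightarrow> openin (prod_topology Z Z) U \<and>
     (\<exists>s. continuous_map (subtopology (prod_topology Z Z) U) (path_space Z) s \<and>
          (\<forall>p\<in>U. endpoints (s p) = p))"

lemma has_motion_planner_iff_sectional:
  "has_motion_planner Z n \<longleftrightarrow>
     (\<exists>U. (\<forall>i\<in>{1..n}. sectional Z (U i)) \<and> (\<Union>i\<in>{1..n}. U i) = topspace (prod_topology Z Z))"
  (is "_ \<longleftrightarrow> ?R")
proof
  assume "has_motion_planner Z n"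
  then obtain U s where "\<forall>i\<in>{1..n}. openin (prod_topology Z Z) (U i)"
      and U: "(\<Union>i\<in>{1..n}. U i) = topspace (prod_topology Z Z)"
      and "\<forall>i\<in>{1..n}. continuous_map (subtopology (prod_topology Z Z) (U i)) (path_space Z) (s i) \<and>
          (\<forall>p\<in>U i. endpoints (s i p) = p)"
    unfolding has_motion_planner_def by blast
  then have "\<forall>i\<in>{1..n}. sectional Z (U i)"
    unfolding sectional_def by blast
  with U show ?R by (intro exI[of _ U] conjI)
next
  assume ?R
  then obtain U where U: "\<forall>i\<in>{1..n}. sectional Z (U i)"
      "(\<Union>i\<in>{1..n}. U i) = topspace (prod_topology Z Z)" by blast
  have "\<forall>i\<in>{1..n}. \<exists>s. continuous_map (subtopology (prod_topology Z Z) (U i)) (path_space Z) s \<and>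
          (\<forall>p\<in>U i. endpoints (s p) = p)"
    using U(1) unfolding sectional_def by blast
  from bchoice[OF this] obtain s where s: "\<forall>i\<in>{1..n}.
      continuous_map (subtopology (prod_topology Z Z) (U i)) (path_space Z) (s i) \<and>
      (\<forall>p\<in>U i. endpoints (s i p) = p)" ..
  have "\<forall>i\<in>{1..n}. openin (prod_topology Z Z) (U i)"
    using U(1) unfolding sectional_def by blast
  with U(2) s show "has_motion_planner Z n"
    unfolding has_motion_planner_def by (intro exI[of _ U] exI[of _ s] conjI)
qed

lemma sectional_empty [simp]: "sectional Z {}"
  by (simp add: sectional_def)

lemma sectional_subset:
  assumes "sectional Z U" "openin (prod_topology Z Z) V" "V \<subseteq> U"
  shows "sectional Z V"
proof -
  obtain s where "continuous_map (subtopology (prod_topology Z Z) U) (path_space Z) s"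
      "\<forall>p\<in>U. endpoints (s p) = p"
    using assms(1) unfolding sectional_def by blast
  then have "continuous_map (subtopology (prod_topology Z Z) V) (path_space Z) s"
      "\<forall>p\<in>V. endpoints (s p) = p"
    using assms(3) continuous_map_from_subtopology_mono by blast+
  with assms(2) show ?thesis
    unfolding sectional_def by blast
qed

text \<open>Over disjoint open sets the sections have nothing to agree on, so they paste to one
  continuous section, however many pieces there are.\<close>

lemma sectional_UN_disjoint:
  assumes sec: "\<And>k. k \<in> I \<Longrightarrow> sectional Z (U k)" and dis: "disjoint_family_on U I"
  shows "sectional Z (\<Union>k\<in>I. U k)"
proof -
  let ?Z = "prod_topology Z Z" and ?U = "\<Union>k\<in>I. U k"
  have "\<forall>k\<in>I. \<exists>s. continuous_map (subtopology ?Z (U k)) (path_space Z) s \<and> (\<forall>p\<in>U k. endpoints (s p) = p)"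
    using sec unfolding sectional_def by blast
  from bchoice[OF this] obtain s where
    s: "\<And>k. k \<in> I \<Longrightarrow> continuous_map (subtopology ?Z (U k)) (path_space Z) (s k)"
       "\<And>k p. k \<in> I \<Longrightarrow> p \<in> U k \<Longrightarrow> endpoints (s k p) = p"
    by blast
  have op: "openin ?Z (U k)" if "k \<in> I" for k
    using sec[OF that] by (simp add: sectional_def)
  have opU: "openin (subtopology ?Z ?U) (U k)" if "k \<in> I" for k
    using op[OF that] that by (auto simp: openin_subtopology intro!: exI[of _ "U k"])
  have cont: "continuous_map (subtopology (subtopology ?Z ?U) (U k)) (path_space Z) (s k)"
    if "k \<in> I" for k
  proof -
    have "?U \<inter> U k = U k" using that by blast
    then show ?thesis
      using s(1)[OF that] by (simp add: subtopology_subtopology)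
  qed
  have agree: "s i p = s j p"
    if "i \<in> I" "j \<in> I" "p \<in> topspace (subtopology ?Z ?U) \<inter> U i \<inter> U j" for i j p
    using dis that by (cases "i = j") (auto simp: disjoint_family_on_def)
  have sub: "topspace (subtopology ?Z ?U) \<subseteq> ?U"
    by simp
  obtain g where g: "continuous_map (subtopology ?Z ?U) (path_space Z) g"
    "\<And>p k. k \<in> I \<Longrightarrow> p \<in> topspace (subtopology ?Z ?U) \<inter> U k \<Longrightarrow> g p = s k p"
    proof (rule pasting_lemma_exists[where f = s, OF sub opU cont agree])
    fix g assume "continuous_map (subtopology ?Z ?U) (path_space Z) g"
      "\<And>p k. k \<in> I \<Longrightarrow> p \<in> topspace (subtopology ?Z ?U) \<inter> U k \<Longrightarrow> g p = s k p"
    then show thesis by (rule that)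
  qed
  have "endpoints (g p) = p" if "p \<in> U k" "k \<in> I" for p k
  proof -
    have "p \<in> topspace (subtopology ?Z ?U) \<inter> U k"
      using that openin_subset[OF op[OF that(2)]] by auto
    from g(2)[OF that(2) this] show ?thesis
      using s(2)[OF that(2,1)] by simp
  qed
  then have "\<forall>p\<in>?U. endpoints (g p) = p" by blast
  moreover have "openin ?Z ?U" using op by blast
  ultimately show ?thesis
    unfolding sectional_def using g(1) by blast
qed

text \<open>The planner of \<open>Y\<close> is conjugated with the paths \<open>up a\<close> and \<open>up b\<close> leading into the image of \<open>Y\<close>.\<close>

lemma sectional_pullback:
  assumes V: "openin Z V"
    and r: "continuous_map (subtopology Z V) Y r"
    and \<phi>: "continuous_map Y Z \<phi>"
    and up: "continuous_map (subtopology Z V) (path_space Z) up"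
    and up0: "\<And>c. c \<in> V \<Longrightarrow> up c 0 = c"
    and up1: "\<And>c. c \<in> V \<Longrightarrow> up c 1 = \<phi> (r c)"
    and U: "sectional Y U"
  shows "sectional Z {(a, b). a \<in> V \<and> b \<in> V \<and> (r a, r b) \<in> U}"
proof -
  let ?V = "subtopology Z V" and ?O = "{(a, b). a \<in> V \<and> b \<in> V \<and> (r a, r b) \<in> U}"
  obtain s where s: "continuous_map (subtopology (prod_topology Y Y) U) (path_space Y) s"
      "\<And>p. p \<in> U \<Longrightarrow> endpoints (s p) = p" and U': "openin (prod_topology Y Y) U"
    using U unfolding sectional_def by blast
  have VV: "prod_topology ?V ?V = subtopology (prod_topology Z Z) (V \<times> V)"
    by (simp add: subtopology_Times)
  have "topspace ?V = V"
    using openin_subset[OF V] by auto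
  have rr: "continuous_map (prod_topology ?V ?V) (prod_topology Y Y) (\<lambda>(a, b). (r a, r b))"
    using r by (simp add: continuous_map_prod_top)
  have "?O = {p \<in> V \<times> V. (\<lambda>(a, b). (r a, r b)) p \<in> U}"
    by auto
  then have "?O = {p \<in> topspace (prod_topology ?V ?V). (\<lambda>(a, b). (r a, r b)) p \<in> U}"
    unfolding topspace_prod_topology \<open>topspace ?V = V\<close> .
  then have "openin (prod_topology ?V ?V) ?O"
    using openin_continuous_map_preimage[OF rr U'] by simp
  then have O: "openin (prod_topology Z Z) ?O"
    unfolding VV by (rule openin_trans_full) (simp add: openin_prod_Times_iff V)
  have sub: "subtopology (prod_topology Z Z) ?O = subtopology (prod_topology ?V ?V) ?O"
    unfolding VV subtopology_subtopology by (rule arg_cong) auto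
  let ?S = "subtopology (prod_topology Z Z) ?O"
  have tO: "topspace ?S = ?O"
    using openin_subset[OF O] by auto
  have f1: "continuous_map ?S ?V fst" and f2: "continuous_map ?S ?V snd"
    unfolding sub by (rule continuous_map_from_subtopology, simp add: continuous_map_fst continuous_map_snd)+
  have m1: "continuous_map ?S (path_space Z) (\<lambda>p. up (fst p))"
    using continuous_map_compose[OF f1 up] by (simp add: o_def)
  have m3: "continuous_map ?S (path_space Z) (\<lambda>p. rev_path (up (snd p)))"
    using continuous_map_compose[OF f2 up] by (intro continuous_map_rev_path) (simp add: o_def)
  have "continuous_map ?S (subtopology (prod_topology Y Y) U) (\<lambda>(a, b). (r a, r b))"
    using rr unfolding sub
    by (auto simp: continuous_map_in_subtopology continuous_map_from_subtopology)
  then have "continuous_map ?S (path_space Y) (s \<circ> (\<lambda>(a, b). (r a, r b)))"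
    using s(1) by (rule continuous_map_compose)
  then have m2: "continuous_map ?S (path_space Z)
      (\<lambda>p. restrict (\<phi> \<circ> (s \<circ> (\<lambda>(a, b). (r a, r b))) p) {0..1})"
    using \<phi> by (rule continuous_map_path_space_postcompose)
  have ends: "s (r a, r b) 0 = r a" "s (r a, r b) 1 = r b" if "(a, b) \<in> ?O" for a b
    using s(2)[of "(r a, r b)"] that by (auto simp: endpoints_def)
  \<comment> \<open>The three pieces fit: \<open>up a\<close> ends at \<open>\<phi> (r a)\<close>,
    where the transported planner path starts, and that path ends at \<open>\<phi> (r b)\<close>,
    where the reversed \<open>up b\<close> starts.\<close>
  let ?t = "\<lambda>p. join_path (up (fst p)) (join_path
      (restrict (\<phi> \<circ> (s \<circ> (\<lambda>(a, b). (r a, r b))) p) {0..1}) (rev_path (up (snd p))))"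
  have "continuous_map ?S (path_space Z) ?t"
    using m1 m2 m3
    by (intro continuous_map_join_path) (auto simp: tO ends up1)
  moreover have "endpoints (?t p) = p" if "p \<in> ?O" for p
    using that by (auto simp: endpoints_def up0)
  ultimately show ?thesis
    using O unfolding sectional_def by blast
qed


subsection \<open>Flowing up the telescope\<close>

lemma continuous_map_from_sum_topology:
  assumes "\<And>i. i \<in> I \<Longrightarrow> continuous_map (X i) Y (\<lambda>x. g (i, x))"
  shows "continuous_map (sum_topology X I) Y g"
  unfolding continuous_map_openin_preimage_eq
proof (intro conjI allI impI)
  show "g \<in> topspace (sum_topology X I) \<rightarrow> topspace Y"
    using assms by (auto simp: continuous_map_def Pi_iff)
  fix U assume "openin Y U"
  then have "openin (X i) {x \<in> topspace (X i). g (i, x) \<in> U}" if "i \<in> I" for i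
    using openin_continuous_map_preimage assms that by fastforce
  moreover have "{x. (i, x) \<in> topspace (sum_topology X I) \<inter> g -` U} = {x \<in> topspace (X i). g (i, x) \<in> U}"
    if "i \<in> I" for i
    using that by auto
  ultimately show "openin (sum_topology X I) (topspace (sum_topology X I) \<inter> g -` U)"
    by (auto simp: openin_sum_topology)
qed

lemma continuous_map_subtopology_cylinder:
  assumes "continuous_map (prod_topology A (top_of_set B)) Z g" "C \<subseteq> UNIV \<times> B"
  shows "continuous_map (subtopology (prod_topology A (top_of_set D)) C) Z g"
proof -
  let ?C = "subtopology (prod_topology A (top_of_set D)) C"
  have "continuous_map ?C A fst"
    by (rule continuous_map_from_subtopology) (rule continuous_map_fst)
  moreover have "continuous_map ?C (top_of_set D) snd"
    by (rule continuous_map_from_subtopology) (rule continuous_map_snd)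
  then have "continuous_map ?C (top_of_set B) snd"
    using assms(2) by (auto simp: continuous_map_in_subtopology)
  ultimately have "continuous_map ?C (prod_topology A (top_of_set B)) (\<lambda>p. (fst p, snd p))"
    by (simp add: continuous_map_pairwise o_def)
  from continuous_map_compose[OF this assms(1)] show ?thesis
    by (simp add: o_def)
qed

text \<open>The composite of \<open>f i\<close>, ..., \<open>f (i + n - 1)\<close>. Peeling off the
  first map rather than the last makes the recursion match the gluing of
  \<open>(i, x, real i)\<close> with \<open>(Suc i, f i x, real i)\<close>.\<close>

primrec tower :: "(nat \<Rightarrow> 'a \<Rightarrow> 'a) \<Rightarrow> nat \<Rightarrow> nat \<Rightarrow> 'a \<Rightarrow> 'a" where
  "tower f 0 i x = x"
| "tower f (Suc n) i x = tower f n (Suc i) (f i x)"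

locale telescope_system =
  fixes X :: "nat \<Rightarrow> 'a topology" and f :: "nat \<Rightarrow> 'a \<Rightarrow> 'a"
  assumes continuous_f: "i \<ge> 1 \<Longrightarrow> continuous_map (X i) (X (Suc i)) (f i)"
begin

abbreviation cylinder :: "nat \<Rightarrow> ('a \<times> real) topology" where
  "cylinder i \<equiv> prod_topology (X i) (top_of_set {real i - 1..real i})"

definition cl :: "nat \<times> 'a \<times> real \<Rightarrow> (nat \<times> 'a \<times> real) set" where
  "cl p = telescope_rel X f `` {p}"

text \<open>Choosing a representative lets functions on classes be written as formulas in triples;
  the value is meaningful once \<phi> respects the gluing.\<close>

definition lift :: "(nat \<times> 'a \<times> real \<Rightarrow> 'b) \<Rightarrow> (nat \<times> 'a \<times> real) set \<Rightarrow> 'b" where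
  "lift \<phi> c = \<phi> (SOME p. p \<in> c)"

definition height :: "(nat \<times> 'a \<times> real) set \<Rightarrow> real" where
  "height = lift (\<lambda>p. snd (snd p))"

definition below :: "nat \<Rightarrow> (nat \<times> 'a \<times> real) set set" where
  "below k = {c \<in> topspace (mapping_telescope X f). height c < real k}"

text \<open>At integer heights both adjacent cylinders represent the same class; the upper one is chosen.\<close>

definition flow :: "nat \<Rightarrow> 'a \<Rightarrow> real \<Rightarrow> (nat \<times> 'a \<times> real) set" where
  "flow i x u = (let j = Suc (nat \<lfloor>u\<rfloor>) in cl (j, tower f (j - i) i x, u))"

text \<open>Compatibility with the gluing is required at every integer height. Beyond level
  \<open>k\<close> the formula would descend and need not be compatible, so a constant default is
  taken there.\<close>

definition rise :: "nat \<Rightarrow> (nat \<times> 'a \<times> real) set \<Rightarrow> real \<Rightarrow> (nat \<times> 'a \<times> real) set" where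
  "rise k = lift (\<lambda>(i, x, t). if t < real k
     then restrict (\<lambda>s. flow i x (t + s * (real k - t))) {0..1} else undefined)"

text \<open>The default has the same purpose as in \<open>rise\<close>: for \<open>i > k\<close> the
  truncated difference is 0, and the glued triples would receive the values \<open>x\<close> and
  \<open>f i x\<close>.\<close>

definition land :: "nat \<Rightarrow> (nat \<times> 'a \<times> real) set \<Rightarrow> 'a" where
  "land k = lift (\<lambda>(i, x, t). if t < real k then tower f (Suc k - i) i x else undefined)"

section \<open>Functions on the telescope defined through representatives\<close>

lemma telescope_sum_cylinder: "telescope_sum X = sum_topology cylinder {1..}"
  by (simp add: telescope_sum_def)

lemma quotient_map_cl: "quotient_map (telescope_sum X) (mapping_telescope X f) cl"
proof -
  have "cl = (\<lambda>p. telescope_rel X f `` {p})" by (simp add: cl_def fun_eq_iff)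
  then show ?thesis
    unfolding mapping_telescope_def
    using quotient_map_quotient_topology[OF equiv_telescope_rel] by simp
qed

lemma topspace_telescope:
  "topspace (mapping_telescope X f) = cl ` topspace (telescope_sum X)"
  using quotient_imp_surjective_map[OF quotient_map_cl] by simp

lemma in_topspace_telescopeE:
  assumes "c \<in> topspace (mapping_telescope X f)"
  obtains i x t where "c = cl (i, x, t)" "i \<ge> 1" "x \<in> topspace (X i)" "real i - 1 \<le> t" "t \<le> real i"
  using assms unfolding topspace_telescope telescope_sum_def by auto

lemma in_telescope_sum:
  "(i, x, t) \<in> topspace (telescope_sum X) \<longleftrightarrow>
     i \<ge> 1 \<and> x \<in> topspace (X i) \<and> real i - 1 \<le> t \<and> t \<le> real i"
  by (auto simp: telescope_sum_def)

lemma f_in_topspace: "i \<ge> 1 \<Longrightarrow> x \<in> topspace (X i) \<Longrightarrow> f i x \<in> topspace (X (Suc i))"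
  using continuous_f[of i] by (auto simp: continuous_map_def)

lemma cl_step:
  assumes "i \<ge> 1" "x \<in> topspace (X i)"
  shows "cl (i, x, real i) = cl (Suc i, f i x, real i)"
  unfolding cl_def
proof (rule equiv_class_eq[OF equiv_telescope_rel])
  show "((i, x, real i), (Suc i, f i x, real i)) \<in> telescope_rel X f"
    using assms f_in_topspace[OF assms]
    by (auto simp: telescope_rel_def in_telescope_sum intro!: r_into_equivclp telescope_step.intros)
qed

text \<open>Invariance under the generating identifications spreads to the equivalence closure by
  induction along a chain of steps in either direction.\<close>

lemma lift_cl:
  assumes inv: "\<And>i x. i \<ge> 1 \<Longrightarrow> x \<in> topspace (X i) \<Longrightarrow> \<phi> (i, x, real i) = \<phi> (Suc i, f i x, real i)"
    and p: "p \<in> topspace (telescope_sum X)"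
  shows "lift \<phi> (cl p) = \<phi> p"
proof -
  have "p \<in> cl p"
    unfolding cl_def by (rule equiv_class_self[OF equiv_telescope_rel p])
  then have "(SOME q. q \<in> cl p) \<in> cl p"
    by (rule someI)
  then have "equivclp (telescope_step X f) p (SOME q. q \<in> cl p)"
    unfolding cl_def telescope_rel_def by blast
  then have "\<phi> p = \<phi> (SOME q. q \<in> cl p)"
    by (induction rule: equivclp_induct) (auto elim!: telescope_step.cases simp: inv)
  then show ?thesis
    by (simp add: lift_def)
qed

lemma height_cl:
  assumes "(i, x, t) \<in> topspace (telescope_sum X)"
  shows "height (cl (i, x, t)) = t"
  unfolding height_def by (subst lift_cl[OF _ assms]) auto

lemma continuous_map_height: "continuous_map (mapping_telescope X f) euclideanreal height"
proof (rule continuous_compose_quotient_map[OF quotient_map_cl])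
  have "continuous_map (telescope_sum X) euclideanreal (\<lambda>p. snd (snd p))"
    unfolding telescope_sum_def
    by (rule continuous_map_from_sum_topology)
       (auto intro: continuous_map_into_fulltopology continuous_map_snd)
  then show "continuous_map (telescope_sum X) euclideanreal (height \<circ> cl)"
    by (rule continuous_map_eq) (auto simp: height_cl)
qed

lemma openin_below: "openin (mapping_telescope X f) (below k)"
  unfolding below_def
  using openin_continuous_map_preimage[OF continuous_map_height, of "{..<real k}"] by auto

text \<open>Continuity is checked upstairs: \<open>below k\<close> is open, so the quotient map
  restricts to a quotient map from its preimage, which is the sum of the truncated cylinders.
  Cylinders with index above \<open>k\<close> start at height at least \<open>k\<close> and are cut
  to nothing, so only \<open>i \<le> k\<close> matters.\<close>

lemma continuous_map_lift_below:
  assumes inv: "\<And>i x. i \<ge> 1 \<Longrightarrow> x \<in> topspace (X i) \<Longrightarrow> \<phi> (i, x, real i) = \<phi> (Suc i, f i x, real i)"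
    and cont: "\<And>i. i \<ge> 1 \<Longrightarrow> i \<le> k \<Longrightarrow>
      continuous_map (subtopology (cylinder i) (UNIV \<times> {..<real k})) Y (\<lambda>p. \<phi> (i, p))"
  shows "continuous_map (subtopology (mapping_telescope X f) (below k)) Y (lift \<phi>)"
proof -
  let ?U = "Sigma {1..} (\<lambda>i. UNIV \<times> {..<real k})"
  have "topspace (telescope_sum X) \<inter> {p \<in> topspace (telescope_sum X). cl p \<in> below k} =
      topspace (telescope_sum X) \<inter> ?U"
    by (auto simp: below_def topspace_telescope height_cl in_telescope_sum)
  from arg_cong[OF this, of "subtopology (telescope_sum X)"]
  have "subtopology (telescope_sum X) {p \<in> topspace (telescope_sum X). cl p \<in> below k} =
      subtopology (telescope_sum X) ?U"
    by (simp only: subtopology_restrict)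
  also have "\<dots> = sum_topology (\<lambda>i. subtopology (cylinder i) (UNIV \<times> {..<real k})) {1..}"
    unfolding telescope_sum_cylinder by (rule subtopology_sum_topology)
  finally have sub: "subtopology (telescope_sum X) {p \<in> topspace (telescope_sum X). cl p \<in> below k} =
      sum_topology (\<lambda>i. subtopology (cylinder i) (UNIV \<times> {..<real k})) {1..}" .
  have "continuous_map (sum_topology (\<lambda>i. subtopology (cylinder i) (UNIV \<times> {..<real k})) {1..}) Y \<phi>"
  proof (rule continuous_map_from_sum_topology)
    fix i :: nat assume "i \<in> {1..}"
    then show "continuous_map (subtopology (cylinder i) (UNIV \<times> {..<real k})) Y (\<lambda>p. \<phi> (i, p))"
    proof (cases "i \<le> k")
      case False
      then have "topspace (subtopology (cylinder i) (UNIV \<times> {..<real k})) = {}"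
        by auto
      then have "subtopology (cylinder i) (UNIV \<times> {..<real k}) = trivial_topology"
        by (simp only: null_topspace_iff_trivial)
      then show ?thesis
        by simp
    qed (use cont in auto)
  qed
  then have "continuous_map (subtopology (telescope_sum X) {p \<in> topspace (telescope_sum X). cl p \<in> below k}) Y \<phi>"
    unfolding sub .
  then have "continuous_map (subtopology (telescope_sum X) {p \<in> topspace (telescope_sum X). cl p \<in> below k}) Y (lift \<phi> \<circ> cl)"
    by (rule continuous_map_eq) (simp add: lift_cl[of \<phi>, OF inv])
  then show ?thesis
    by (rule continuous_compose_quotient_map[rotated])
       (rule quotient_map_restriction[OF quotient_map_cl refl], simp add: openin_below)
qed

section \<open>Continuity of the upward flow\<close>

lemma continuous_map_tower: "i \<ge> 1 \<Longrightarrow> continuous_map (X i) (X (i + n)) (tower f n i)"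
proof (induction n arbitrary: i)
  case (Suc n)
  then have "continuous_map (X (Suc i)) (X (Suc i + n)) (tower f n (Suc i))"
    using Suc.IH[of "Suc i"] by simp
  from continuous_map_compose[OF continuous_f[OF Suc.prems] this]
  have "continuous_map (X i) (X (i + Suc n)) (\<lambda>x. tower f n (Suc i) (f i x))"
    by (simp add: o_def)
  then show ?case
    by (rule continuous_map_eq) simp
qed (simp add: continuous_map_eq[OF continuous_map_id])

text \<open>At height \<open>u \<ge> real i\<close> the chosen cylinder has index at least
  \<open>Suc i\<close>, so the tower is nonempty and its first map is \<open>f i\<close>.\<close>

lemma flow_step:
  assumes "u \<ge> real i"
  shows "flow i x u = flow (Suc i) (f i x) u"
proof -
  have "i \<le> nat \<lfloor>u\<rfloor>"
    using assms by (simp add: le_nat_floor)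
  then have "Suc (nat \<lfloor>u\<rfloor>) - i = Suc (Suc (nat \<lfloor>u\<rfloor>) - Suc i)"
    by simp
  then show ?thesis
    by (simp add: flow_def Let_def)
qed

text \<open>Below the top of cylinder \<open>i\<close> the tower is empty; at the top the floor
  jumps to cylinder \<open>Suc i\<close>, and the gluing compensates.\<close>

lemma flow_eq_cl:
  assumes "i \<ge> 1" "x \<in> topspace (X i)" "real i - 1 \<le> u" "u \<le> real i"
  shows "flow i x u = cl (i, x, u)"
proof (cases "u = real i")
  case True
  then show ?thesis
    using cl_step[OF assms(1,2)] by (simp add: flow_def Suc_diff_le)
next
  case False
  then have "\<lfloor>u\<rfloor> = int i - 1"
    using assms by (intro floor_unique) auto
  then have "Suc (nat \<lfloor>u\<rfloor>) = i"
    using assms(1) by simp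
  then show ?thesis
    by (simp add: flow_def Let_def)
qed

lemma continuous_map_cylinder_cl:
  assumes "i \<ge> 1"
  shows "continuous_map (cylinder i) (mapping_telescope X f) (\<lambda>p. cl (i, p))"
proof -
  have "continuous_map (cylinder i) (telescope_sum X) (\<lambda>p. (i, p))"
    unfolding telescope_sum_cylinder using assms
    by (intro continuous_map_component_injection) simp
  from continuous_map_compose[OF this quotient_imp_continuous_map[OF quotient_map_cl]]
  show ?thesis by (simp add: o_def)
qed

text \<open>Induction on the number of further cylinders that are crossed: the strip is split at
  height \<open>i\<close>, above which the flow is that of \<open>f i x\<close> started in cylinder
  \<open>Suc i\<close>.\<close>

lemma continuous_map_flow:
  assumes "i \<ge> 1"
  shows "continuous_map (prod_topology (X i) (top_of_set {real i - 1..real (i + n)}))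
    (mapping_telescope X f) (\<lambda>p. flow i (fst p) (snd p))"
  using assms
proof (induction n arbitrary: i)
  case 0
  have "continuous_map (prod_topology (X i) (top_of_set {real i - 1..real (i + 0)}))
    (mapping_telescope X f) (\<lambda>p. cl (i, p))"
    using continuous_map_cylinder_cl[OF 0] by simp
  then show ?case
    by (rule continuous_map_eq) (use 0 in \<open>auto simp: flow_eq_cl\<close>)
next
  case (Suc n)
  let ?P = "prod_topology (X i) (top_of_set {real i - 1..real (i + Suc n)})"
  have "continuous_map ?P (mapping_telescope X f)
     (\<lambda>p. if snd p \<le> real i then cl (i, p) else flow (Suc i) (f i (fst p)) (snd p))"
  proof (rule continuous_map_cases_le)
    show "continuous_map ?P euclideanreal snd"
      by (auto intro: continuous_map_into_fulltopology continuous_map_snd)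
    show "continuous_map ?P euclideanreal (\<lambda>p. real i)"
      by simp
    show "continuous_map (subtopology ?P {p \<in> topspace ?P. snd p \<le> real i}) (mapping_telescope X f) (\<lambda>p. cl (i, p))"
      by (rule continuous_map_subtopology_cylinder[OF continuous_map_cylinder_cl[OF Suc.prems]]) auto
    \<comment> \<open>The upper strip from \<open>i\<close> to \<open>i + Suc n\<close> is exactly
      the range from \<open>Suc i - 1\<close> to \<open>Suc i + n\<close> in the induction
      hypothesis for \<open>Suc i\<close>.\<close>
    have "continuous_map (prod_topology (X i) (top_of_set {real i..real (i + Suc n)}))
        (prod_topology (X (Suc i)) (top_of_set {real (Suc i) - 1..real (Suc i + n)})) (\<lambda>p. (f i (fst p), snd p))"
      using continuous_map_compose[OF continuous_map_fst continuous_f[OF Suc.prems]]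
      by (simp add: continuous_map_pairwise o_def continuous_map_snd)
    from continuous_map_compose[OF this Suc.IH]
    have "continuous_map (prod_topology (X i) (top_of_set {real i..real (i + Suc n)})) (mapping_telescope X f)
        (\<lambda>p. flow (Suc i) (f i (fst p)) (snd p))"
      by (simp add: o_def)
    then show "continuous_map (subtopology ?P {p \<in> topspace ?P. real i \<le> snd p}) (mapping_telescope X f)
        (\<lambda>p. flow (Suc i) (f i (fst p)) (snd p))"
      by (rule continuous_map_subtopology_cylinder) auto
    show "cl (i, p) = flow (Suc i) (f i (fst p)) (snd p)" if "p \<in> topspace ?P" "snd p = real i" for p
    proof -
      have "cl (i, p) = cl (i, fst p, snd p)" by simp
      also have "\<dots> = flow i (fst p) (snd p)"
        by (rule flow_eq_cl[symmetric]) (use that Suc.prems in auto)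
      also have "\<dots> = flow (Suc i) (f i (fst p)) (snd p)"
        by (rule flow_step) (use that in simp)
      finally show ?thesis .
    qed
  qed
  then show ?case
    by (rule continuous_map_eq) (use Suc.prems in \<open>auto simp: flow_eq_cl flow_step\<close>)
qed

lemma rise_cl:
  assumes "(i, x, t) \<in> topspace (telescope_sum X)" "t < real k"
  shows "rise k (cl (i, x, t)) = restrict (\<lambda>s. flow i x (t + s * (real k - t))) {0..1}"
  unfolding rise_def
  by (subst lift_cl[OF _ assms(1)]) (auto simp: assms(2) fun_eq_iff intro!: flow_step)

lemma land_cl:
  assumes "(i, x, t) \<in> topspace (telescope_sum X)" "t < real k"
  shows "land k (cl (i, x, t)) = tower f (Suc k - i) i x"
  unfolding land_def
  by (subst lift_cl[OF _ assms(1)]) (auto simp: assms(2) Suc_diff_le)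

lemma continuous_map_land:
  "continuous_map (subtopology (mapping_telescope X f) (below k)) (X (Suc k)) (land k)"
  unfolding land_def
proof (rule continuous_map_lift_below)
  fix i assume i: "1 \<le> i" "i \<le> k"
  have "continuous_map (X i) (X (Suc k)) (tower f (Suc k - i) i)"
    using continuous_map_tower[OF i(1), of "Suc k - i"] i by simp
  from continuous_map_compose[OF continuous_map_fst this]
  have "continuous_map (cylinder i) (X (Suc k)) (\<lambda>p. tower f (Suc k - i) i (fst p))"
    by (simp add: o_def)
  then have "continuous_map (subtopology (cylinder i) (UNIV \<times> {..<real k})) (X (Suc k))
      (\<lambda>p. tower f (Suc k - i) i (fst p))"
    by (rule continuous_map_from_subtopology)
  then show "continuous_map (subtopology (cylinder i) (UNIV \<times> {..<real k})) (X (Suc k))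
      (\<lambda>p. case (i, p) of (i, x, t) \<Rightarrow> if t < real k then tower f (Suc k - i) i x else undefined)"
    by (rule continuous_map_eq) auto
qed (auto simp: Suc_diff_le)

text \<open>On each truncated cylinder the flow is a jointly continuous function of point and time;
  currying gives a map into the path space, and this map descends to the open set
  \<open>below k\<close>.\<close>

lemma continuous_map_rise:
  "continuous_map (subtopology (mapping_telescope X f) (below k)) (path_space (mapping_telescope X f)) (rise k)"
  unfolding rise_def
proof (rule continuous_map_lift_below)
  fix i x assume "1 \<le> i" "x \<in> topspace (X i)"
  have "flow i x (real i + s * (real k - real i)) = flow (Suc i) (f i x) (real i + s * (real k - real i))"
    if "real i < real k" "s \<in> {0..1}" for s
    using that by (intro flow_step) auto
  then show "(case (i, x, real i) of (i, x, t) \<Rightarrow>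
      if t < real k then restrict (\<lambda>s. flow i x (t + s * (real k - t))) {0..1} else undefined) =
    (case (Suc i, f i x, real i) of (i, x, t) \<Rightarrow>
      if t < real k then restrict (\<lambda>s. flow i x (t + s * (real k - t))) {0..1} else undefined)"
    by (auto intro!: restrict_ext)
next
  fix i assume i: "1 \<le> i" "i \<le> k"
  let ?C = "subtopology (cylinder i) (UNIV \<times> {..<real k})"
  let ?P = "prod_topology ?C (top_of_set {0..1::real})"
  let ?u = "\<lambda>q. snd (fst q) + snd q * (real k - snd (fst q))"
  have 1: "continuous_map ?P (X i) (\<lambda>q. fst (fst q))"
    using continuous_map_compose[OF continuous_map_fst continuous_map_from_subtopology[OF continuous_map_fst]]
    by (simp add: o_def)
  have 2: "continuous_map ?P euclideanreal (\<lambda>q. snd (fst q))"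
    using continuous_map_compose[OF continuous_map_fst
        continuous_map_from_subtopology[OF continuous_map_into_fulltopology[OF continuous_map_snd]]]
    by (simp add: o_def)
  have 3: "continuous_map ?P euclideanreal snd"
    by (rule continuous_map_into_fulltopology[OF continuous_map_snd])
  have "continuous_map ?P euclideanreal ?u"
    using 2 3 by (intro continuous_map_add continuous_map_real_mult continuous_map_diff) auto
  \<comment> \<open>The height is a convex combination of \<open>t\<close> and \<open>k\<close>, so
    it never leaves the strip on which the flow is known to be continuous.\<close>
  moreover have "?u q \<in> {real i - 1..real k}" if q: "q \<in> topspace ?P" for q
  proof -
    obtain x t s where [simp]: "q = ((x, t), s)" by (cases q) auto
    have t: "real i - 1 \<le> t" "t < real k" "0 \<le> s" "s \<le> 1"
      using q by auto
    then have "0 \<le> s * (real k - t)" "s * (real k - t) \<le> real k - t"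
      by (auto intro: mult_left_le_one_le)
    with t have "real i - 1 \<le> t + s * (real k - t)" "t + s * (real k - t) \<le> real k"
      by linarith+
    then show ?thesis by simp
  qed
  ultimately have "continuous_map ?P (top_of_set {real i - 1..real (i + (k - i))}) ?u"
    using i by (auto simp: continuous_map_in_subtopology)
  with 1 have "continuous_map ?P (prod_topology (X i) (top_of_set {real i - 1..real (i + (k - i))}))
      (\<lambda>q. (fst (fst q), ?u q))"
    by (simp add: continuous_map_pairwise o_def)
  from continuous_map_compose[OF this continuous_map_flow[OF i(1)]]
  have "continuous_map ?P (mapping_telescope X f) (\<lambda>q. flow i (fst (fst q)) (?u q))"
    by (simp add: o_def)
  from continuous_map_curry_path_space[OF this]
  show "continuous_map ?C (path_space (mapping_telescope X f)) (\<lambda>p. case (i, p) of (i, x, t) \<Rightarrow>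
      if t < real k then restrict (\<lambda>s. flow i x (t + s * (real k - t))) {0..1} else undefined)"
    by (rule continuous_map_eq) auto
qed

lemma in_belowE:
  assumes "c \<in> below k"
  obtains i x t where "c = cl (i, x, t)" "i \<ge> 1" "x \<in> topspace (X i)" "real i - 1 \<le> t" "t \<le> real i"
    "(i, x, t) \<in> topspace (telescope_sum X)" "t < real k"
proof -
  have c: "c \<in> topspace (mapping_telescope X f)" "height c < real k"
    using assms by (auto simp: below_def)
  from c(1) obtain i x t where p: "c = cl (i, x, t)" "i \<ge> 1" "x \<in> topspace (X i)" "real i - 1 \<le> t" "t \<le> real i"
    by (rule in_topspace_telescopeE)
  then have S: "(i, x, t) \<in> topspace (telescope_sum X)"
    by (simp add: in_telescope_sum)
  show thesis
    by (rule that[OF p S]) (use c p height_cl[OF S] in simp)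
qed

lemma rise_start:
  assumes "c \<in> below k"
  shows "rise k c 0 = c"
  using assms by (rule in_belowE) (simp add: rise_cl flow_eq_cl)

text \<open>At time 1 the height is \<open>k\<close>, whose floor selects cylinder
  \<open>Suc k\<close>: the path ends on the bottom of that cylinder.\<close>

lemma rise_end:
  assumes "c \<in> below k"
  shows "rise k c 1 = cl (Suc k, land k c, real k)"
  using assms by (rule in_belowE) (simp add: rise_cl land_cl flow_def)

text \<open>The pullback is taken along \<open>land k\<close>, with \<phi> the inclusion of
  \<open>X (Suc k)\<close> as the bottom of cylinder \<open>Suc k\<close>. Level \<open>k\<close> is
  parametrized by \<open>X (Suc k)\<close> and not by \<open>X k\<close>, since the gluing sends
  each top point of cylinder \<open>k\<close> to its image under \<open>f k\<close>.\<close>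

lemma sectional_below:
  assumes "sectional (X (Suc k)) U"
  shows "sectional (mapping_telescope X f)
    {(a, b). a \<in> below k \<and> b \<in> below k \<and> (land k a, land k b) \<in> U}"
proof (rule sectional_pullback[OF openin_below continuous_map_land _ continuous_map_rise rise_start _ assms])
  have "continuous_map (X (Suc k)) (cylinder (Suc k)) (\<lambda>y. (y, real k))"
    by (simp add: continuous_map_pairwise o_def)
  from continuous_map_compose[OF this continuous_map_cylinder_cl]
  show "continuous_map (X (Suc k)) (mapping_telescope X f) (\<lambda>y. cl (Suc k, y, real k))"
    by (simp add: o_def)
qed (simp_all add: rise_end)

end


subsection \<open>Topological complexity of the telescope\<close>

text \<open>The cover is padded with empty sets.\<close>

lemma has_motion_planner_mono:
  assumes "has_motion_planner Z m" "m \<le> n"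
  shows "has_motion_planner Z n"
proof -
  obtain U where U: "\<forall>i\<in>{1..m}. sectional Z (U i)"
      "(\<Union>i\<in>{1..m}. U i) = topspace (prod_topology Z Z)"
    using assms(1) unfolding has_motion_planner_iff_sectional by blast
  let ?U = "\<lambda>i. if i \<le> m then U i else {}"
  have "\<forall>i\<in>{1..n}. sectional Z (?U i)"
    using U(1) by simp
  moreover have "(\<Union>i\<in>{1..n}. ?U i) = (\<Union>i\<in>{1..m}. U i)"
  proof -
    have "{1..n} \<inter> {i. i \<le> m} = {1..m}"
      using assms(2) by auto
    then show ?thesis by simp
  qed
  ultimately show ?thesis
    unfolding has_motion_planner_iff_sectional U(2)[symmetric] by (intro exI[of _ ?U] conjI)
qed

text \<open>A finite bound excludes the empty set, whose infimum is infinite; a nonempty set in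
  \<open>enat\<close> attains its infimum, and monotonicity leads from there to
  \<open>n\<close>.\<close>

lemma TC_le_enat_iff: "TC Z \<le> enat n \<longleftrightarrow> has_motion_planner Z n"
proof
  assume le: "TC Z \<le> enat n"
  then have "{enat n | n. has_motion_planner Z n} \<noteq> {}"
    by (auto simp: TC_def Inf_enat_def split: if_splits)
  then have "TC Z \<in> {enat n | n. has_motion_planner Z n}"
    unfolding TC_def Inf_enat_def by (auto intro: LeastI)
  with le show "has_motion_planner Z n"
    by (auto intro: has_motion_planner_mono)
next
  assume "has_motion_planner Z n"
  then show "TC Z \<le> enat n"
    unfolding TC_def by (intro Inf_lower) blast
qed

context telescope_system
begin

lemma land_in_topspace: "c \<in> below k \<Longrightarrow> land k c \<in> topspace (X (Suc k))"
  using continuous_map_land[of k] openin_subset[OF openin_below[of k]]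
  by (auto simp: continuous_map_def)

lemma height_nonneg: "c \<in> topspace (mapping_telescope X f) \<Longrightarrow> 0 \<le> height c"
  by (erule in_topspace_telescopeE) (auto simp: height_cl in_telescope_sum)

lemma has_motion_planner_telescope:
  assumes "\<And>i. i \<ge> 1 \<Longrightarrow> has_motion_planner (X i) n"
  shows "has_motion_planner (mapping_telescope X f) (2 * n)"
proof -
  let ?T = "mapping_telescope X f"
  let ?TT = "prod_topology ?T ?T"
  let ?m = "\<lambda>p. max (height (fst p)) (height (snd p))"
  \<comment> \<open>Covers are chosen for all levels at once, each with the same number
    \<open>n\<close> of sets, so that sets of equal index can be united across levels.\<close>
  have "\<forall>k. \<exists>U. (\<forall>j\<in>{1..n}. sectional (X (Suc k)) (U j)) \<and>
      (\<Union>j\<in>{1..n}. U j) = topspace (prod_topology (X (Suc k)) (X (Suc k)))"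
    using assms unfolding has_motion_planner_iff_sectional by simp
  from choice[OF this] obtain U where U: "\<And>k j. j \<in> {1..n} \<Longrightarrow> sectional (X (Suc k)) (U k j)"
      and cover: "\<And>k. (\<Union>j\<in>{1..n}. U k j) = topspace (prod_topology (X (Suc k)) (X (Suc k)))"
    by blast
  define B where "B k j = {(a, b). a \<in> below k \<and> b \<in> below k \<and> (land k a, land k b) \<in> U k j}" for k j
  define D where "D k j = B k j \<inter> {p. real k - 2 < ?m p}" for k j
  have height: "?m p < real k" if "p \<in> D k j" for p k j
    using that by (auto simp: D_def B_def below_def)
  have sec: "sectional ?T (D k j)" if "j \<in> {1..n}" for k j
  proof (rule sectional_subset)
    show B: "sectional ?T (B k j)"
      unfolding B_def by (rule sectional_below[OF U[OF that]])
    have "continuous_map ?TT euclideanreal ?m"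
      using continuous_map_compose[OF continuous_map_fst continuous_map_height]
        continuous_map_compose[OF continuous_map_snd continuous_map_height]
      by (intro continuous_map_real_max) (simp_all add: o_def)
    from openin_continuous_map_preimage[OF this, of "{real k - 2<..}"]
    have "openin ?TT (B k j \<inter> {p \<in> topspace ?TT. ?m p \<in> {real k - 2<..}})"
      using B by (intro openin_Int) (auto simp: sectional_def)
    moreover have "B k j \<inter> {p \<in> topspace ?TT. ?m p \<in> {real k - 2<..}} = D k j"
      using B openin_subset[of ?TT "B k j"] unfolding sectional_def D_def by blast
    ultimately show "openin ?TT (D k j)" by simp
  qed (simp add: D_def)
  have dis: "disjoint_family_on (\<lambda>k. D k j) {k. even k = e}" for j e
    unfolding disjoint_family_on_def
  proof (intro ballI impI)
    \<comment> \<open>Pairs in the lower band have larger height below \<open>k \<le> l - 2\<close>,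
      while those in the upper band have it above \<open>l - 2\<close>.\<close>
    have apart: "D k j \<inter> D l j = {}" if "k + 2 \<le> l" for k l
      using height[of _ k j] that by (fastforce simp: D_def)
    fix k l :: nat assume "k \<in> {k. even k = e}" "l \<in> {k. even k = e}" "k \<noteq> l"
    then have "even k = even l" "k \<noteq> l" by simp_all
    then have "k + 2 \<le> l \<or> l + 2 \<le> k" by presburger
    then show "D k j \<inter> D l j = {}"
      using apart[of k l] apart[of l k] by blast
  qed
  \<comment> \<open>Indices up to \<open>n\<close> collect the even levels, and indices from
    \<open>n + 1\<close> to \<open>2 * n\<close>, shifted back by \<open>n\<close>, the odd
    ones.\<close>
  define W where "W i = (if i \<le> n then \<Union>k\<in>{k. even k = True}. D k i
     else \<Union>k\<in>{k. even k = False}. D k (i - n))" for i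
  have "sectional ?T (W i)" if "i \<in> {1..2 * n}" for i
  proof (cases "i \<le> n")
    case True
    then show ?thesis
      using that unfolding W_def by (simp only: if_True) (intro sectional_UN_disjoint sec dis, simp)
  next
    case False
    then show ?thesis
      using that unfolding W_def by (simp only: if_False) (intro sectional_UN_disjoint sec dis, auto)
  qed
  moreover have "(\<Union>i\<in>{1..2 * n}. W i) = topspace ?TT"
  proof (rule subset_antisym)
    have "W i \<subseteq> topspace ?TT" if "i \<in> {1..2 * n}" for i
      using openin_subset \<open>\<And>i. i \<in> {1..2 * n} \<Longrightarrow> sectional ?T (W i)\<close>[OF that]
      unfolding sectional_def by blast
    then show "(\<Union>i\<in>{1..2 * n}. W i) \<subseteq> topspace ?TT" by blast
  next
    show "topspace ?TT \<subseteq> (\<Union>i\<in>{1..2 * n}. W i)"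
    proof
      fix p assume "p \<in> topspace ?TT"
      then obtain a b where p: "p = (a, b)" "a \<in> topspace ?T" "b \<in> topspace ?T"
        by auto
      \<comment> \<open>This is the least level strictly above both heights, so the larger height is
        at least \<open>k - 1\<close> and the pair lies in band \<open>k\<close>. Nonnegativity of
        heights makes \<open>nat\<close> harmless.\<close>
      define k where "k = Suc (nat \<lfloor>?m p\<rfloor>)"
      have "0 \<le> ?m p"
        using height_nonneg[OF p(2)] p(1) by simp
      then have k: "real k - 2 < ?m p" "?m p < real k"
        unfolding k_def by linarith+
      then have ab: "a \<in> below k" "b \<in> below k"
        using p by (auto simp: below_def)
      then have "(land k a, land k b) \<in> (\<Union>j\<in>{1..n}. U k j)"
        unfolding cover by (simp add: land_in_topspace)
      then obtain j where j: "j \<in> {1..n}" "(land k a, land k b) \<in> U k j" by blast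
      then have D: "p \<in> D k j"
        using ab k p by (simp add: D_def B_def)
      show "p \<in> (\<Union>i\<in>{1..2 * n}. W i)"
      proof (cases "even k")
        case True
        then have "p \<in> W j" using j D by (auto simp: W_def)
        moreover have "j \<in> {1..2 * n}" using j by simp
        ultimately show ?thesis by blast
      next
        case False
        then have "p \<in> W (n + j)" using j D by (auto simp: W_def)
        moreover have "n + j \<in> {1..2 * n}" using j by simp
        ultimately show ?thesis by blast
      qed
    qed
  qed
  ultimately show ?thesis
    unfolding has_motion_planner_iff_sectional by blast
qed

end

theorem corollary6:
  fixes X :: "nat \<Rightarrow> 'a topology"
    and f :: "nat \<Rightarrow> 'a \<Rightarrow> 'a"
  assumes "\<And>i. i \<ge> 1 \<Longrightarrow> continuous_map (X i) (X (Suc i)) (f i)"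
  shows "TC (mapping_telescope X f) \<le> 2 * (SUP i\<in>{1..}. TC (X i))"
proof (cases "SUP i\<in>{1..}. TC (X i)")
  case (enat n)
  interpret telescope_system X f
    using assms by unfold_locales
  \<comment> \<open>The finite supremum serves as a bound common to all \<open>i\<close>, as the
    choice of covers with equally many sets requires.\<close>
  have "has_motion_planner (X i) n" if "i \<ge> 1" for i
    using SUP_upper[of i "{1..}" "\<lambda>i. TC (X i)"] that enat by (simp add: TC_le_enat_iff)
  then have "TC (mapping_telescope X f) \<le> enat (2 * n)"
    unfolding TC_le_enat_iff by (rule has_motion_planner_telescope)
  also have "enat (2 * n) = 2 * enat n"
    by (simp add: numeral_eq_enat)
  finally show ?thesis
    unfolding enat .
next
  case infinity
  have "(2 :: enat) * \<infinity> = \<infinity>"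
    by (simp add: numeral_eq_enat)
  then show ?thesis
    unfolding infinity by simp
qed

end
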